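(* Let $(X,\|\cdot\|)$ be a Banach space, $J:X\to X$ a nonexpansive mapping and $A=I-J$. Let $U_0\in X$ and let $U$ be the solution on $[0,+\infty)$ of $U'(t)=-A(U(t))$ with $U(0)=U_0$. Let $x_0\in X$, let $\{\lambda_n\}_{n\ge1}$ be a sequence in $[0,1]$, and let $x_n=x_{n-1}-\lambda_nA(x_{n-1})$ for $n\ge1$. Then for any $t>0$ and any $k\in\mathbb N$ such that $\sigma_k:=\sum_{i=1}^k\lambda_i=t$, $$\frac{\|x_k-U(t)\|}{t}\leq\frac{\|x_0-U_0\|+\|A(U_0)\|\sqrt t}{t}.$$
   Context: $J$ nonexpansive means $\|J(x)-J(y)\|\le\|x-y\|$ for all $x,y\in X$. $I$ is the identity of $X$. The solution $U$ exists and is unique by the Cauchy-Lipschitz theorem. *)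

theory Defs
  imports "HOL-Analysis.Analysis"
begin

end

theory Submission
  imports Defs
begin

text \<open>
  Put \<open>D = \<parallel>x\<^sub>0 - U\<^sub>0\<parallel>\<close>, \<open>M = \<parallel>A U\<^sub>0\<parallel>\<close> and \<open>\<tau>\<^sub>k = \<Sum>i=1..k. \<lambda>\<^sub>i\<^sup>2\<close>. The theorem is the case \<open>s = \<sigma>\<^sub>k\<close> of a
  Kobayashi-type estimate, valid for all \<open>k\<close> and all \<open>s \<ge> 0\<close>,
  \<open>\<parallel>x\<^sub>k - U(s)\<parallel> \<le> D + M * sqrt ((\<sigma>\<^sub>k - s)\<^sup>2 + \<tau>\<^sub>k)\<close>,
  because \<open>\<lambda>\<^sub>i \<in> [0,1]\<close> gives \<open>\<tau>\<^sub>k \<le> \<sigma>\<^sub>k\<close>.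

  The estimate is proved by induction on \<open>k\<close>. For \<open>\<lambda>\<^sub>k > 0\<close>, the identity
  \<open>x\<^sub>k - U + \<lambda>\<^sub>k (U - J U) = (1 - \<lambda>\<^sub>k) (x\<^sub>k\<^sub>-\<^sub>1 - U) + \<lambda>\<^sub>k (J x\<^sub>k\<^sub>-\<^sub>1 - J U)\<close>
  shows that \<open>g\<^sub>k(s) = \<parallel>x\<^sub>k - U(s)\<parallel>\<close> satisfies \<open>\<lambda>\<^sub>k g\<^sub>k' + g\<^sub>k \<le> g\<^sub>k\<^sub>-\<^sub>1\<close> in integrated form. Hence
  any \<open>\<psi>\<close> with \<open>\<psi>(0) \<ge> g\<^sub>k(0)\<close> and \<open>\<lambda>\<^sub>k \<psi>' + \<psi> \<ge> g\<^sub>k\<^sub>-\<^sub>1\<close> dominates \<open>g\<^sub>k\<close>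
  (lemma \<open>explicit_step_comparison\<close>), and the bound above is such a \<open>\<psi>\<close>, by the tangent line
  inequality for \<open>sqrt\<close> (lemma \<open>sqrt_tangent_step\<close>). The boundary values come from the speed bounds
  \<open>\<parallel>U(s) - U\<^sub>0\<parallel> \<le> s M\<close> and \<open>\<parallel>x\<^sub>k - U\<^sub>0\<parallel> \<le> D + \<sigma>\<^sub>k M\<close>.
\<close>

text \<open>
  A maximum argument in place of Gronwall's inequality: with \<open>M = \<parallel>J (U 0) - U 0\<parallel>\<close>, if \<open>m\<close> is the largest value of
  \<open>\<parallel>U(r) - U(0)\<parallel> - r M\<close> on \<open>[0,s]\<close>, then the derivative of \<open>e\<^sup>r (U(r) - U(0))\<close> is bounded by that
  of \<open>e\<^sup>r (m + r M)\<close>, and integrating up to a maximum point forces \<open>m \<le> 0\<close>.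
\<close>

lemma nonexpansive_flow_displacement:
  fixes J :: "'a::real_normed_vector \<Rightarrow> 'a" and U :: "real \<Rightarrow> 'a"
  assumes nonexp: "\<And>u v. norm (J u - J v) \<le> norm (u - v)"
    and ode: "\<And>s. s \<ge> 0 \<Longrightarrow> (U has_vector_derivative J (U s) - U s) (at s within {0..})"
    and "s \<ge> 0"
  shows "norm (U s - U 0) \<le> s * norm (J (U 0) - U 0)"
proof -
  define M where "M = norm (J (U 0) - U 0)"
  define w where "w r = norm (U r - U 0) - r * M" for r
  have contU: "continuous_on {0..b} U" for b
    by (rule continuous_on_subset[of "{0..}"])
      (auto simp: continuous_on_eq_continuous_within intro: has_vector_derivative_continuous ode)
  have "continuous_on {0..s} w"
    unfolding w_def by (intro continuous_intros contU)
  then obtain p where p: "p \<in> {0..s}" and max: "\<And>r. r \<in> {0..s} \<Longrightarrow> w r \<le> w p"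
    using continuous_attains_sup[of "{0..s}" w] \<open>s \<ge> 0\<close> by auto
  define m where "m = w p"
  have "m \<le> 0"
  proof (cases "p = 0")
    case True
    then show ?thesis by (simp add: m_def w_def)
  next
    case False
    then have "0 < p" using p by auto
    define f where "f r = exp r *\<^sub>R (U r - U 0)" for r
    define F where "F r = exp r * (m + r * M)" for r
    have f': "(f has_vector_derivative exp r *\<^sub>R (J (U r) - U 0)) (at r)" if "0 < r" for r
    proof -
      have "(U has_vector_derivative J (U r) - U r) (at r)"
        using ode[of r] that at_within_interior[of r "{0::real..}"] by auto
      then show ?thesis
        unfolding f_def
        by (auto intro!: derivative_eq_intros simp: algebra_simps)
    qed
    have F': "(F has_vector_derivative exp r * (m + r * M + M)) (at r)" for r
      unfolding F_def has_real_derivative_iff_has_vector_derivative[symmetric]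
      by (auto intro!: derivative_eq_intros simp: algebra_simps)
    have bound: "norm (exp r *\<^sub>R (J (U r) - U 0)) \<le> exp r * (m + r * M + M)"
      if "0 < r" "r < p" for r
    proof -
      have "norm (J (U r) - U 0) \<le> norm (J (U r) - J (U 0)) + norm (J (U 0) - U 0)"
        using norm_triangle_ineq[of "J (U r) - J (U 0)" "J (U 0) - U 0"] by simp
      also have "\<dots> \<le> norm (U r - U 0) + M"
        using nonexp[of "U r" "U 0"] by (simp add: M_def)
      also have "\<dots> \<le> m + r * M + M"
        using max[of r] that p by (simp add: m_def w_def)
      finally show ?thesis by simp
    qed
    have "norm (f p - f 0) \<le> F p - F 0"
    proof (rule differentiable_bound_general[OF \<open>0 < p\<close>])
      show "continuous_on {0..p} f"
        unfolding f_def by (intro continuous_intros contU)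
      show "continuous_on {0..p} F"
        unfolding F_def by (intro continuous_intros)
    qed (use f' F' bound in auto)
    moreover have "norm (U p - U 0) = m + p * M"
      by (simp add: m_def w_def)
    ultimately show ?thesis
      by (simp add: f_def F_def)
  qed
  then show ?thesis
    using max[of s] \<open>s \<ge> 0\<close> by (simp add: m_def w_def M_def)
qed

text \<open>
  Comparison principle for one explicit step \<open>y\<close> from \<open>x\<close> with step size \<open>l\<close>: \<open>\<psi>\<close> is a
  supersolution of \<open>l g' + g = \<parallel>x - U(s)\<parallel>\<close>, of which \<open>g(s) = \<parallel>y - U(s)\<parallel>\<close> is a subsolution. The
  integrating factor is \<open>exp (s/l)\<close>.
\<close>

lemma explicit_step_comparison:
  fixes J :: "'a::real_normed_vector \<Rightarrow> 'a" and U :: "real \<Rightarrow> 'a" and \<psi> :: "real \<Rightarrow> real"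
  assumes nonexp: "\<And>u v. norm (J u - J v) \<le> norm (u - v)"
    and ode: "\<And>s. s \<ge> 0 \<Longrightarrow> (U has_vector_derivative J (U s) - U s) (at s within {0..})"
    and l: "0 < l" "l \<le> 1"
    and y: "y = (1 - l) *\<^sub>R x + l *\<^sub>R J x"
    and deriv: "\<And>r. (\<psi> has_real_derivative \<psi>' r) (at r)"
    and super: "\<And>r. r \<ge> 0 \<Longrightarrow> norm (x - U r) \<le> \<psi> r + l * \<psi>' r"
    and init: "norm (y - U 0) \<le> \<psi> 0"
    and "s \<ge> 0"
  shows "norm (y - U s) \<le> \<psi> s"
proof (cases "s = 0")
  case True
  then show ?thesis using init by simp
next
  case False
  then have "0 < s" using \<open>s \<ge> 0\<close> by simp
  define f where "f r = exp (r / l) *\<^sub>R (y - U r)" for r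
  define f' where "f' r = (exp (r / l) / l) *\<^sub>R ((1 - l) *\<^sub>R (x - U r) + l *\<^sub>R (J x - J (U r)))" for r
  define F where "F r = exp (r / l) * \<psi> r" for r
  define F' where "F' r = exp (r / l) / l * (\<psi> r + l * \<psi>' r)" for r
  have f_deriv: "(f has_vector_derivative f' r) (at r)" if "0 < r" for r
  proof -
    have U: "(U has_vector_derivative J (U r) - U r) (at r)"
      using ode[of r] that at_within_interior[of r "{0::real..}"] by auto
    have E: "((\<lambda>r. exp (r / l)) has_real_derivative exp (r / l) / l) (at r)"
      using l by (auto intro!: derivative_eq_intros)
    have "(f has_vector_derivative
        exp (r / l) *\<^sub>R (0 - (J (U r) - U r)) + (exp (r / l) / l) *\<^sub>R (y - U r)) (at r)"
      unfolding f_def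
      by (intro has_vector_derivative_scaleR[OF E] has_vector_derivative_diff
          has_vector_derivative_const U)
    moreover have "exp (r / l) *\<^sub>R (0 - (J (U r) - U r)) + (exp (r / l) / l) *\<^sub>R (y - U r) = f' r"
    proof -
      have "exp (r / l) *\<^sub>R (0 - (J (U r) - U r))
          = (exp (r / l) / l) *\<^sub>R (l *\<^sub>R (U r - J (U r)))"
        using l by simp
      then show ?thesis
        unfolding f'_def y
        by (simp only: scaleR_add_right[symmetric]) (simp add: algebra_simps)
    qed
    ultimately show ?thesis by simp
  qed
  have F_deriv: "(F has_vector_derivative F' r) (at r)" for r
    unfolding F_def F'_def has_real_derivative_iff_has_vector_derivative[symmetric]
    using l by (auto intro!: derivative_eq_intros deriv simp: field_simps)
  have bound: "norm (f' r) \<le> F' r" if "0 < r" for r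
  proof -
    have "norm ((1 - l) *\<^sub>R (x - U r) + l *\<^sub>R (J x - J (U r)))
        \<le> (1 - l) * norm (x - U r) + l * norm (J x - J (U r))"
      using norm_triangle_ineq[of "(1 - l) *\<^sub>R (x - U r)" "l *\<^sub>R (J x - J (U r))"] l by simp
    also have "\<dots> \<le> (1 - l) * norm (x - U r) + l * norm (x - U r)"
      using nonexp[of x "U r"] l by simp
    also have "\<dots> = norm (x - U r)"
      by (simp add: algebra_simps)
    also have "\<dots> \<le> \<psi> r + l * \<psi>' r"
      using super that by simp
    finally show ?thesis
      unfolding f'_def F'_def using l by (simp add: divide_right_mono)
  qed
  have contU: "continuous_on {0..s} U"
    by (rule continuous_on_subset[of "{0..}"])
      (auto simp: continuous_on_eq_continuous_within intro: has_vector_derivative_continuous ode)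
  have "continuous_on {0..s} \<psi>"
    by (auto intro!: continuous_at_imp_continuous_on DERIV_isCont deriv)
  then have "continuous_on {0..s} F"
    unfolding F_def using l by (intro continuous_intros) auto
  moreover have "continuous_on {0..s} f"
    unfolding f_def using l by (intro continuous_intros contU) auto
  ultimately have "norm (f s - f 0) \<le> F s - F 0"
    using f_deriv F_deriv bound by (intro differentiable_bound_general[OF \<open>0 < s\<close>]) auto
  moreover have "norm (f 0) \<le> F 0"
    using init by (simp add: f_def F_def)
  ultimately have "norm (f s) \<le> F s"
    using norm_triangle_ineq2[of "f s" "f 0"] by linarith
  then show ?thesis
    by (simp add: f_def F_def)
qed

text \<open>
  Supersolution property of \<open>s \<mapsto> sqrt ((\<sigma> - s)\<^sup>2 + \<tau>)\<close>, whose derivative is \<open>- a\<close> over its value,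
  where \<open>a = \<sigma> - s\<close>: the left-hand side is \<open>sqrt (v - 2 l a)\<close> with \<open>v = a\<^sup>2 + \<tau>\<close>, and the right-hand
  side is the tangent of \<open>sqrt\<close> at \<open>v\<close>.
\<close>

lemma sqrt_tangent_step:
  fixes a l \<tau> :: real
  assumes "l\<^sup>2 \<le> \<tau>" "0 < \<tau>"
  shows "sqrt ((a - l)\<^sup>2 + (\<tau> - l\<^sup>2)) \<le> sqrt (a\<^sup>2 + \<tau>) + l * (- a / sqrt (a\<^sup>2 + \<tau>))"
proof -
  define q where "q = sqrt (a\<^sup>2 + \<tau>)"
  define p where "p = sqrt ((a - l)\<^sup>2 + (\<tau> - l\<^sup>2))"
  have q: "0 < q" "q\<^sup>2 = a\<^sup>2 + \<tau>"
    using assms by (auto simp: q_def add_nonneg_pos)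
  have p: "p\<^sup>2 = q\<^sup>2 - 2 * l * a"
    using assms by (simp add: p_def q) (simp add: power2_eq_square algebra_simps)
  have "0 \<le> (p - q)\<^sup>2"
    by simp
  also have "\<dots> = 2 * (q\<^sup>2 - l * a - p * q)"
    by (simp add: power2_diff p)
  finally have "p * q \<le> q\<^sup>2 - l * a"
    by simp
  then have "p \<le> (q\<^sup>2 - l * a) / q"
    using q by (simp add: pos_le_divide_eq)
  also have "\<dots> = q + l * (- a / q)"
    using q by (simp add: field_simps power2_eq_square)
  finally show ?thesis
    by (simp add: p_def q_def)
qed

lemma nonexpansive_iteration_displacement:
  fixes J :: "'a::real_normed_vector \<Rightarrow> 'a" and x :: "nat \<Rightarrow> 'a"
  assumes nonexp: "\<And>u v. norm (J u - J v) \<le> norm (u - v)"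
    and lam: "\<And>n. n \<ge> 1 \<Longrightarrow> lam n \<in> {0..1}"
    and step: "\<And>n. x (Suc n) = (1 - lam (Suc n)) *\<^sub>R x n + lam (Suc n) *\<^sub>R J (x n)"
  shows "norm (x k - z) \<le> norm (x 0 - z) + (\<Sum>i=1..k. lam i) * norm (J z - z)"
proof (induction k)
  case 0
  then show ?case by simp
next
  case (Suc k)
  define l where "l = lam (Suc k)"
  have l: "0 \<le> l" "l \<le> 1"
    using lam[of "Suc k"] by (auto simp: l_def)
  have "x (Suc k) - z = (1 - l) *\<^sub>R (x k - z) + l *\<^sub>R (J (x k) - z)"
    by (simp add: step l_def algebra_simps)
  then have "norm (x (Suc k) - z) \<le> (1 - l) * norm (x k - z) + l * norm (J (x k) - z)"
    using norm_triangle_ineq[of "(1 - l) *\<^sub>R (x k - z)" "l *\<^sub>R (J (x k) - z)"] l by simp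
  also have "\<dots> \<le> (1 - l) * norm (x k - z) + l * (norm (x k - z) + norm (J z - z))"
    using norm_triangle_ineq[of "J (x k) - J z" "J z - z"] nonexp[of "x k" z] l
    by (intro add_left_mono mult_left_mono) auto
  finally have "norm (x (Suc k) - z) \<le> norm (x k - z) + l * norm (J z - z)"
    by (simp add: algebra_simps)
  then show ?case
    using Suc.IH by (simp add: l_def algebra_simps)
qed

text \<open>
  The Kobayashi-type estimate between the iteration at index \<open>k\<close> and the flow at an arbitrary time.
\<close>

lemma iteration_flow_distance:
  fixes J :: "'a::real_normed_vector \<Rightarrow> 'a" and U :: "real \<Rightarrow> 'a" and x :: "nat \<Rightarrow> 'a"
  assumes nonexp: "\<And>u v. norm (J u - J v) \<le> norm (u - v)"
    and ode: "\<And>s. s \<ge> 0 \<Longrightarrow> (U has_vector_derivative J (U s) - U s) (at s within {0..})"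
    and lam: "\<And>n. n \<ge> 1 \<Longrightarrow> lam n \<in> {0..1}"
    and step: "\<And>n. x (Suc n) = (1 - lam (Suc n)) *\<^sub>R x n + lam (Suc n) *\<^sub>R J (x n)"
    and "s \<ge> 0"
  shows "norm (x k - U s) \<le> norm (x 0 - U 0)
      + norm (J (U 0) - U 0) * sqrt (((\<Sum>i=1..k. lam i) - s)\<^sup>2 + (\<Sum>i=1..k. (lam i)\<^sup>2))"
  using \<open>s \<ge> 0\<close>
proof (induction k arbitrary: s)
  case 0
  have "norm (x 0 - U s) \<le> norm (x 0 - U 0) + norm (U s - U 0)"
    using norm_triangle_ineq4[of "x 0 - U 0" "U s - U 0"] by simp
  also have "norm (U s - U 0) \<le> s * norm (J (U 0) - U 0)"
    by (rule nonexpansive_flow_displacement[OF nonexp ode \<open>0 \<le> s\<close>])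
  finally show ?case
    using 0 by (simp add: mult.commute)
next
  case (Suc k)
  define l where "l = lam (Suc k)"
  define D where "D = norm (x 0 - U 0)"
  define M where "M = norm (J (U 0) - U 0)"
  define \<sigma> where "\<sigma> = (\<Sum>i=1..Suc k. lam i)"
  define \<tau> where "\<tau> = (\<Sum>i=1..Suc k. (lam i)\<^sup>2)"
  have sums: "(\<Sum>i=1..k. lam i) = \<sigma> - l" "(\<Sum>i=1..k. (lam i)\<^sup>2) = \<tau> - l\<^sup>2"
    by (simp_all add: \<sigma>_def \<tau>_def l_def)
  have y: "x (Suc k) = (1 - l) *\<^sub>R x k + l *\<^sub>R J (x k)"
    by (simp add: step l_def)
  have "M \<ge> 0"
    by (simp add: M_def)
  have IH: "norm (x k - U r) \<le> D + M * sqrt ((\<sigma> - l - r)\<^sup>2 + (\<tau> - l\<^sup>2))" if "r \<ge> 0" for r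
    using Suc.IH[OF that] unfolding sums D_def M_def .
  have "norm (x (Suc k) - U s) \<le> D + M * sqrt ((\<sigma> - s)\<^sup>2 + \<tau>)"
  proof (cases "l = 0")
    case True
    then show ?thesis
      using IH[OF \<open>0 \<le> s\<close>] y by simp
  next
    case False
    then have l: "0 < l" "l \<le> 1"
      using lam[of "Suc k"] by (auto simp: l_def)
    have \<tau>: "l\<^sup>2 \<le> \<tau>"
      using sum_nonneg[of "{1..k}" "\<lambda>i. (lam i)\<^sup>2"] sums by simp
    then have "0 < \<tau>"
      using zero_less_power[OF l(1), of 2] by linarith
    define \<psi> where "\<psi> r = D + M * sqrt ((\<sigma> - r)\<^sup>2 + \<tau>)" for r
    define \<psi>' where "\<psi>' r = M * (- (\<sigma> - r) / sqrt ((\<sigma> - r)\<^sup>2 + \<tau>))" for r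
    have deriv: "(\<psi> has_real_derivative \<psi>' r) (at r)" for r
    proof -
      have "0 < (\<sigma> - r)\<^sup>2 + \<tau>"
        using \<open>0 < \<tau>\<close> by (simp add: add_nonneg_pos)
      then show ?thesis
        unfolding \<psi>_def \<psi>'_def by (auto intro!: derivative_eq_intros simp: field_simps)
    qed
    have super: "norm (x k - U r) \<le> \<psi> r + l * \<psi>' r" if "r \<ge> 0" for r
    proof -
      have "sqrt ((\<sigma> - l - r)\<^sup>2 + (\<tau> - l\<^sup>2))
          \<le> sqrt ((\<sigma> - r)\<^sup>2 + \<tau>) + l * (- (\<sigma> - r) / sqrt ((\<sigma> - r)\<^sup>2 + \<tau>))"
        using sqrt_tangent_step[OF \<tau> \<open>0 < \<tau>\<close>, of "\<sigma> - r"] by (simp add: algebra_simps)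
      then have "M * sqrt ((\<sigma> - l - r)\<^sup>2 + (\<tau> - l\<^sup>2))
          \<le> M * (sqrt ((\<sigma> - r)\<^sup>2 + \<tau>) + l * (- (\<sigma> - r) / sqrt ((\<sigma> - r)\<^sup>2 + \<tau>)))"
        by (rule mult_left_mono) fact
      then show ?thesis
        using IH[OF that] unfolding \<psi>_def \<psi>'_def by (simp add: algebra_simps)
    qed
    have "norm (x (Suc k) - U 0) \<le> D + \<sigma> * M"
      using nonexpansive_iteration_displacement
          [where J = J and lam = lam and x = x and k = "Suc k" and z = "U 0", OF nonexp lam step]
      by (simp add: D_def M_def \<sigma>_def)
    moreover have "\<sigma> * M \<le> sqrt (\<sigma>\<^sup>2 + \<tau>) * M"
      using \<open>0 < \<tau>\<close> \<open>M \<ge> 0\<close> by (intro mult_right_mono real_le_rsqrt) auto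
    ultimately have init: "norm (x (Suc k) - U 0) \<le> \<psi> 0"
      by (simp add: \<psi>_def mult.commute)
    have "norm (x (Suc k) - U s) \<le> \<psi> s"
      by (rule explicit_step_comparison[OF nonexp ode l y deriv super init \<open>0 \<le> s\<close>])
    then show ?thesis
      by (simp add: \<psi>_def)
  qed
  then show ?case
    by (simp only: \<sigma>_def \<tau>_def D_def M_def)
qed

theorem corollary3p13:
  fixes J A :: "'a::banach \<Rightarrow> 'a"
    and U :: "real \<Rightarrow> 'a" and U0 :: 'a
    and x :: "nat \<Rightarrow> 'a" and x0 :: 'a
    and lam :: "nat \<Rightarrow> real"
    and t :: real and k :: nat
  assumes nonexpansive: "\<And>u v. norm (J u - J v) \<le> norm (u - v)"
    and A: "A = (\<lambda>u. u - J u)"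
    and U_ode: "\<And>s. s \<ge> 0 \<Longrightarrow> (U has_vector_derivative - A (U s)) (at s within {0..})"
    and U_init: "U 0 = U0"
    and lam: "\<And>n. n \<ge> 1 \<Longrightarrow> lam n \<in> {0..1}"
    and x_init: "x 0 = x0"
    and x_step: "\<And>n. n \<ge> 1 \<Longrightarrow> x n = x (n - 1) - lam n *\<^sub>R A (x (n - 1))"
    and t: "t > 0"
    and sigma: "(\<Sum>i=1..k. lam i) = t"
  shows "norm (x k - U t) / t \<le> (norm (x0 - U0) + norm (A U0) * sqrt t) / t"
proof -
  have ode: "(U has_vector_derivative J (U s) - U s) (at s within {0..})" if "s \<ge> 0" for s
    using U_ode[OF that] by (simp add: A)
  have step: "x (Suc n) = (1 - lam (Suc n)) *\<^sub>R x n + lam (Suc n) *\<^sub>R J (x n)" for n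
    using x_step[of "Suc n"] by (simp add: A algebra_simps)
  have "(\<Sum>i=1..k. (lam i)\<^sup>2) \<le> (\<Sum>i=1..k. lam i)"
    using lam by (intro sum_mono) (auto simp: power2_eq_square mult_left_le)
  then have "sqrt (\<Sum>i=1..k. (lam i)\<^sup>2) \<le> sqrt t"
    unfolding sigma by (rule real_sqrt_le_mono)
  then have "norm (A U0) * sqrt (\<Sum>i=1..k. (lam i)\<^sup>2) \<le> norm (A U0) * sqrt t"
    by (rule mult_left_mono) simp
  moreover have "norm (x k - U t) \<le> norm (x0 - U0) + norm (A U0) * sqrt (\<Sum>i=1..k. (lam i)\<^sup>2)"
    using iteration_flow_distance
        [where J = J and U = U and lam = lam and x = x and k = k and s = t,
          OF nonexpansive ode lam step] t
    unfolding sigma by (simp add: U_init x_init A norm_minus_commute)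
  ultimately show ?thesis
    using t by (intro divide_right_mono) auto
qed

end
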